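(* Let $V$ be a finite nonempty set and $r=(r(i,j))_{i,j\in V}$ an irreducible family of transition rates with $r(i,i)=0$ for all $i$, and let $\lambda\in\mathbb{R}^V$ be given by $\lambda(j)=\sum_{i\in V}[r(i,j)-r(j,i)]$. For $u\in\Sigma$ let $\zeta^{\lambda,u}$ be the path component of the unique solution of the oblique reflection problem with input $u+t\lambda$, $t\ge0$. A nonempty set $A\subseteq V$ is $r$-absorbing if and only if, for all $u\in\partial_A\Sigma$, $\zeta^{\lambda,u}_t\in\partial_A\Sigma$ for all $t\ge0$.
   Context: $\Sigma=\{u\in[0,1]^V:\sum_{i\in V}u(i)=1\}$; $\partial_A\Sigma=\{\zeta\in\Sigma:\sum_{j\in A}\zeta(j)=1\}$; $1_{\{i\}}\in\mathbb{R}^V$ is the indicator of $i$. Trace rates: for $k\in V$ and nonempty $B\subseteq V$, let $T^k_B$ be the hitting time of $B$ by the continuous-time random walk on $V$ with jump rates $r$ started at $k$, and $T^k_j=T^k_{\{j\}}$. For nonempty $A\subseteq V$ and $i\ne j$ in $A$ put $r^A(i,j)=r(i,j)+\sum_{k\notin A}r(i,k)P(T^k_A=T^k_j)$, and $r^A(i,i)=0$. Put $\lambda^A(i)=\sum_{j\in A}[r^A(j,i)-r^A(i,j)]$ for $i\in A$. A set $A\subseteq V$ is $r$-absorbing if $A=V$ or $\lambda^{A\cup\{j\}}(j)\le0$ for all $j\in V\setminus A$. Oblique reflection problem (ORP): let $p(i,j)=r(i,j)/r(i)$ with $r(i)=\sum_{j\in V}r(i,j)$ (implicitly positive), and $\boldsymbol{w}_i=\sum_{j\in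 V}p(i,j)(1_{\{i\}}-1_{\{j\}})$. Given a right-continuous path $\xi:[0,\infty)\to\mathbb{R}^V$ with left limits, a pair $(\zeta,\rho)$ of such paths solves the ORP with input $\xi$ if (i) for each $i\in V$, $t\mapsto\rho_t(i)$ is nondecreasing and $\rho_t(i)=\int_0^t 1_{\{\zeta_s(i)=0\}}\,d\rho_s(i)$ for all $t\ge0$ (so $\rho_0(i)=0$); (ii) for all $t\ge0$, $\zeta_t=\xi_t+\sum_{i\in V}\rho_t(i)\boldsymbol{w}_i$ and $\zeta_t\in[0,\infty)^V$. It is known (Chen–Mandelbaum) that for each $u\in\Sigma$ there is a unique solution $(\zeta^{\lambda,u},\rho^{\lambda,u})$ of the ORP with input $\xi^u_t=u+t\lambda$, that $\zeta^{\lambda,u}$ is a continuous $\Sigma$-valued path, and that $u\mapsto\zeta^{\lambda,u}$ is continuous for the topology of uniform convergence on compact time sets. *)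

theory Defs
  imports
    "HOL-Analysis.Analysis"
    "HOL-Probability.Distributions"
    "HOL-Probability.Product_PMF"
    "HOL-Probability.Stream_Space"
begin

text \<open>
  The finite nonempty set of sites is the type \<open>'v::finite\<close>, and \<open>r i j\<close> is the rate
  of jumping from \<open>i\<close> to \<open>j\<close>.
\<close>

definition irreducible_rates :: "('v \<Rightarrow> 'v \<Rightarrow> real) \<Rightarrow> bool" where
  "irreducible_rates r \<longleftrightarrow>
     (\<forall>i j. 0 \<le> r i j) \<and> (\<forall>i j. (i, j) \<in> {(k, l). 0 < r k l}\<^sup>*)"

definition out_rate :: "('v::finite \<Rightarrow> 'v \<Rightarrow> real) \<Rightarrow> 'v \<Rightarrow> real" where
  "out_rate r i = (\<Sum>j\<in>UNIV. r i j)"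

definition jump_prob :: "('v::finite \<Rightarrow> 'v \<Rightarrow> real) \<Rightarrow> 'v \<Rightarrow> 'v \<Rightarrow> real" where
  "jump_prob r i j = r i j / out_rate r i"

definition drift :: "('v::finite \<Rightarrow> 'v \<Rightarrow> real) \<Rightarrow> real ^ 'v" where
  "drift r = (\<chi> j. \<Sum>i\<in>UNIV. r i j - r j i)"

definition unit_simplex :: "(real ^ 'v::finite) set" where
  "unit_simplex = {u. (\<forall>i. u $ i \<in> {0..1}) \<and> (\<Sum>i\<in>UNIV. u $ i) = 1}"

definition simplex_face :: "'v set \<Rightarrow> (real ^ 'v::finite) set" where
  "simplex_face A = {z \<in> unit_simplex. (\<Sum>j\<in>A. z $ j) = 1}"


section \<open>The continuous-time random walk and its hitting times\<close>

text \<open>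
  The walk is realised by its jump chain and holding times.  The driving randomness is an
  i.i.d. sequence \<open>(F\<^sub>n, E\<^sub>n)\<close>: \<open>F\<^sub>n\<close> is a random self-map of the sites, \<open>F\<^sub>n i\<close> having
  law \<open>jump_prob r i\<close>, and \<open>E\<^sub>n\<close> is an independent exponential variable with mean 1.  The
  \<open>n\<close>-th visited site \<open>Y\<^sub>n\<close> satisfies \<open>Y\<^sub>n\<^sub>+\<^sub>1 = F\<^sub>n Y\<^sub>n\<close>, and the walk stays there for the time
  \<open>E\<^sub>n / out_rate r Y\<^sub>n\<close>, which given \<open>Y\<^sub>n\<close> is exponential with rate \<open>out_rate r Y\<^sub>n\<close>.
  This requires \<open>out_rate r\<close> to be positive, which for irreducible rates holds as soon
  as there are two sites.
\<close>

definition jump_pmf :: "('v::finite \<Rightarrow> 'v \<Rightarrow> real) \<Rightarrow> 'v \<Rightarrow> 'v pmf" where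
  "jump_pmf r i = embed_pmf (jump_prob r i)"

definition walk_space :: "('v::finite \<Rightarrow> 'v \<Rightarrow> real) \<Rightarrow> (('v \<Rightarrow> 'v) \<times> real) stream measure" where
  "walk_space r =
     stream_space (measure_pmf (Pi_pmf UNIV undefined (jump_pmf r))
                   \<Otimes>\<^sub>M density lborel (exponential_density 1))"

fun jump_chain :: "'v \<Rightarrow> (('v \<Rightarrow> 'v) \<times> real) stream \<Rightarrow> nat \<Rightarrow> 'v" where
  "jump_chain k \<omega> 0 = k"
| "jump_chain k \<omega> (Suc n) = fst (\<omega> !! n) (jump_chain k \<omega> n)"

definition jump_time ::
  "('v::finite \<Rightarrow> 'v \<Rightarrow> real) \<Rightarrow> 'v \<Rightarrow> (('v \<Rightarrow> 'v) \<times> real) stream \<Rightarrow> nat \<Rightarrow> real" where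
  "jump_time r k \<omega> n = (\<Sum>m<n. snd (\<omega> !! m) / out_rate r (jump_chain k \<omega> m))"

text \<open>
  Almost surely the jump times increase to infinity, so the \<open>LEAST\<close> below is over a nonempty
  set and picks the \<open>n\<close> with \<open>jump_time n \<le> t < jump_time (n + 1)\<close>.
\<close>

definition walk ::
  "('v::finite \<Rightarrow> 'v \<Rightarrow> real) \<Rightarrow> 'v \<Rightarrow> (('v \<Rightarrow> 'v) \<times> real) stream \<Rightarrow> real \<Rightarrow> 'v" where
  "walk r k \<omega> t = jump_chain k \<omega> (LEAST n. t < jump_time r k \<omega> (Suc n))"

definition hitting_time ::
  "('v::finite \<Rightarrow> 'v \<Rightarrow> real) \<Rightarrow> 'v \<Rightarrow> 'v set \<Rightarrow> (('v \<Rightarrow> 'v) \<times> real) stream \<Rightarrow> ereal" where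
  "hitting_time r k B \<omega> = (INF t\<in>{t. 0 \<le> t \<and> walk r k \<omega> t \<in> B}. ereal t)"

definition first_hit_prob :: "('v::finite \<Rightarrow> 'v \<Rightarrow> real) \<Rightarrow> 'v set \<Rightarrow> 'v \<Rightarrow> 'v \<Rightarrow> real" where
  "first_hit_prob r A k j =
     measure (walk_space r)
       {\<omega> \<in> space (walk_space r). hitting_time r k A \<omega> = hitting_time r k {j} \<omega>}"


section \<open>Trace rates and absorbing sets\<close>

text \<open>\<open>trace_rate r A i j\<close> and \<open>trace_drift r A i\<close> are meaningful only for \<open>i, j \<in> A\<close>.\<close>

definition trace_rate :: "('v::finite \<Rightarrow> 'v \<Rightarrow> real) \<Rightarrow> 'v set \<Rightarrow> 'v \<Rightarrow> 'v \<Rightarrow> real" where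
  "trace_rate r A i j =
     (if i = j then 0 else r i j + (\<Sum>k\<in>- A. r i k * first_hit_prob r A k j))"

definition trace_drift :: "('v::finite \<Rightarrow> 'v \<Rightarrow> real) \<Rightarrow> 'v set \<Rightarrow> 'v \<Rightarrow> real" where
  "trace_drift r A i = (\<Sum>j\<in>A. trace_rate r A j i - trace_rate r A i j)"

definition absorbing :: "('v::finite \<Rightarrow> 'v \<Rightarrow> real) \<Rightarrow> 'v set \<Rightarrow> bool" where
  "absorbing r A \<longleftrightarrow> A = UNIV \<or> (\<forall>j\<in>- A. trace_drift r (insert j A) j \<le> 0)"


section \<open>The oblique reflection problem\<close>

text \<open>Paths are functions on the reals of which only the values at nonnegative times matter.\<close>

definition cadlag :: "(real \<Rightarrow> 'a::topological_space) \<Rightarrow> bool" where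
  "cadlag f \<longleftrightarrow>
     (\<forall>t\<ge>0. (f \<longlongrightarrow> f t) (at_right t)) \<and> (\<forall>t>0. \<exists>l. (f \<longlongrightarrow> l) (at_left t))"

definition reflection :: "('v::finite \<Rightarrow> 'v \<Rightarrow> real) \<Rightarrow> 'v \<Rightarrow> real ^ 'v" where
  "reflection r i = (\<Sum>j\<in>UNIV. jump_prob r i j *\<^sub>R (axis i 1 - axis j 1))"

text \<open>
  The Stieltjes integral over \<open>(0, t]\<close> is taken against the Lebesgue--Stieltjes measure of
  \<open>s \<mapsto> \<rho> s $ i\<close>, extended to negative times by its value at 0; in particular
  \<open>\<rho> 0 $ i = 0\<close>.
\<close>

definition solves_ORP ::
  "('v::finite \<Rightarrow> 'v \<Rightarrow> real) \<Rightarrow> (real \<Rightarrow> real ^ 'v) \<Rightarrow>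
   (real \<Rightarrow> real ^ 'v) \<Rightarrow> (real \<Rightarrow> real ^ 'v) \<Rightarrow> bool" where
  "solves_ORP r \<xi> \<zeta> \<rho> \<longleftrightarrow>
     cadlag \<zeta> \<and> cadlag \<rho> \<and>
     (\<forall>i. mono_on {0..} (\<lambda>t. \<rho> t $ i)) \<and>
     (\<forall>i. \<forall>t\<ge>0. \<rho> t $ i =
        (LINT s:{0<..t}|interval_measure (\<lambda>s. \<rho> (max 0 s) $ i).
           indicat_real {s. \<zeta> s $ i = 0} s)) \<and>
     (\<forall>t\<ge>0. \<zeta> t = \<xi> t + (\<Sum>i\<in>UNIV. \<rho> t $ i *\<^sub>R reflection r i)) \<and>
     (\<forall>t\<ge>0. \<forall>i. 0 \<le> \<zeta> t $ i)"

end

theory Submission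
  imports Defs
begin

text \<open>
  Let \<open>P\<close> be the jump matrix and \<open>G\<close> the Green function of the jump chain killed in \<open>A\<close>.  The
  maximum principle gives \<open>G = I + P G = I + G P\<close> off \<open>A\<close>, and \<open>trace_drift r (insert j A) j\<close> is
  \<open>\<lambda> G\<close> evaluated at \<open>j\<close>, up to a positive factor; so \<open>A\<close> is absorbing iff \<open>\<lambda> G \<le> 0\<close> off \<open>A\<close>.
  Applying \<open>G\<close> to the reflection equation started on the face gives
  \<open>\<zeta>\<^sub>t G = t \<lambda> G + \<rho>\<^sub>t - (\<rho>\<^sub>t restricted to A) P G\<close> off \<open>A\<close>.  Started inside the face, \<open>\<rho>\<close>
  vanishes on \<open>A\<close> for a short time, so staying on the face forces \<open>t \<lambda> G = - \<rho>\<^sub>t \<le> 0\<close>.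
  Conversely, if \<open>\<lambda> G \<le> 0\<close>, then \<open>\<zeta> G\<close> is \<open>\<rho>\<close> minus a nondecreasing path, and a contraction
  argument for its running suprema shows that it vanishes off \<open>A\<close>.
\<close>

section \<open>Positivity of the exit rates and the jump matrix\<close>

lemma out_rate_pos:
  assumes "irreducible_rates r" "i \<noteq> j"
  shows "0 < out_rate r i"
proof -
  have "(i, j) \<in> {(k, l). 0 < r k l}\<^sup>*" and nonneg: "\<And>k l. 0 \<le> r k l"
    using assms(1) by (auto simp: irreducible_rates_def)
  \<comment> \<open>A path of positive rates to a different site has a first step.\<close>
  then obtain k where "0 < r i k"
    using assms(2) by (auto elim: converse_rtranclE)
  then show ?thesis
    unfolding out_rate_def using nonneg by (intro sum_pos2[of _ k]) auto
qed

text \<open>Positive exit rates make \<open>p\<close> a stochastic matrix. They follow from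
  irreducibility once there are two sites; a single site falls under \<open>A = UNIV\<close>, which
  the theorem settles outside this locale.\<close>

locale irreducible_walk =
  fixes r :: "'v::finite \<Rightarrow> 'v \<Rightarrow> real"
  assumes irreducible: "irreducible_rates r"
    and out_rate_gt_0: "0 < out_rate r i"
begin

abbreviation p :: "'v \<Rightarrow> 'v \<Rightarrow> real" where
  "p \<equiv> jump_prob r"

lemma rate_nonneg: "0 \<le> r i j"
  using irreducible by (auto simp: irreducible_rates_def)

lemma jump_prob_nonneg: "0 \<le> p i j"
  using rate_nonneg out_rate_gt_0[of i] by (simp add: jump_prob_def less_imp_le)

lemma sum_jump_prob: "(\<Sum>j\<in>UNIV. p i j) = 1"
  using out_rate_gt_0[of i] by (simp add: jump_prob_def flip: sum_divide_distrib out_rate_def)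

lemma rate_eq: "r i j = out_rate r i * p i j"
  using out_rate_gt_0[of i] by (simp add: jump_prob_def)

section \<open>The maximum principle\<close>

text \<open>A positive maximum is attained off \<open>C\<close>, where averaging forces it on every
  site reachable by a jump of positive rate. Irreducibility carries it along a path into
  \<open>C\<close>, against the boundary condition.\<close>

lemma subharmonic_nonpos:
  assumes "C \<noteq> {}"
    and boundary: "\<And>k. k \<in> C \<Longrightarrow> g k \<le> 0"
    and subharmonic: "\<And>k. k \<notin> C \<Longrightarrow> g k \<le> (\<Sum>l\<in>UNIV. p k l * g l)"
  shows "g k \<le> 0"
proof -
  define M where "M = Max (range g)"
  have M: "g l \<le> M" for l
    by (simp add: M_def)
  have "M \<in> range g"
    unfolding M_def by (rule Max_in) auto
  then obtain k0 where k0: "g k0 = M"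
    by auto
  have "M \<le> 0"
  proof (rule ccontr)
    assume "\<not> M \<le> 0"
    have step: "g l = M" if "g k = M" "0 < r k l" for k l
    proof (rule ccontr)
      assume "g l \<noteq> M"
      then have "g l < M"
        using M[of l] by simp
      have "0 < p k l"
        using that out_rate_gt_0[of k] by (simp add: jump_prob_def)
      have "(\<Sum>l\<in>UNIV. p k l * g l) < (\<Sum>l\<in>UNIV. p k l * M)"
      proof (rule sum_strict_mono_ex1)
        show "\<forall>l\<in>UNIV. p k l * g l \<le> p k l * M"
          using M jump_prob_nonneg by (auto intro: mult_left_mono)
        show "\<exists>l\<in>UNIV. p k l * g l < p k l * M"
          using mult_strict_left_mono[OF \<open>g l < M\<close> \<open>0 < p k l\<close>] by auto
      qed simp
      also have "\<dots> = M"
        by (simp add: sum_jump_prob flip: sum_distrib_right)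
      finally show False
        using subharmonic[of k] boundary[of k] that \<open>\<not> M \<le> 0\<close> by (cases "k \<in> C") auto
    qed
    obtain c where "c \<in> C"
      using \<open>C \<noteq> {}\<close> by auto
    have "(k0, c) \<in> {(k, l). 0 < r k l}\<^sup>*"
      using irreducible by (auto simp: irreducible_rates_def)
    then have "g c = M"
      by induction (use k0 step in auto)
    then show False
      using boundary[OF \<open>c \<in> C\<close>] \<open>\<not> M \<le> 0\<close> by simp
  qed
  then show ?thesis
    using M[of k] by simp
qed

text \<open>The maximum principle applies to both differences.\<close>

lemma harmonic_unique:
  assumes "C \<noteq> {}"
    and "\<And>k. k \<in> C \<Longrightarrow> g k = g' k"
    and "\<And>k. k \<notin> C \<Longrightarrow> g k - (\<Sum>l\<in>UNIV. p k l * g l) = g' k - (\<Sum>l\<in>UNIV. p k l * g' l)"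
  shows "g k = g' k"
proof (rule antisym)
  show "g k \<le> g' k"
    using subharmonic_nonpos[OF \<open>C \<noteq> {}\<close>, of "\<lambda>k. g k - g' k" k] assms(2,3)
    by (simp add: right_diff_distrib sum_subtractf algebra_simps)
  show "g' k \<le> g k"
    using subharmonic_nonpos[OF \<open>C \<noteq> {}\<close>, of "\<lambda>k. g' k - g k" k] assms(2,3)
    by (simp add: right_diff_distrib sum_subtractf algebra_simps)
qed

section \<open>First-step analysis of the jump chain\<close>

abbreviation "step_space \<equiv>
  measure_pmf (Pi_pmf UNIV undefined (jump_pmf r)) \<Otimes>\<^sub>M density lborel (exponential_density 1)"

lemma pmf_jump_pmf: "pmf (jump_pmf r i) j = p i j"
  unfolding jump_pmf_def
  by (rule pmf_embed_pmf)
     (simp_all add: jump_prob_nonneg nn_integral_count_space_finite sum_ennreal sum_jump_prob)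

lemma prob_space_holding: "prob_space (density lborel (exponential_density 1))"
  by (rule prob_space_exponential_density) simp

sublocale step: prob_space step_space
  by (intro prob_space_pair prob_space_holding prob_space_measure_pmf)

sublocale walk: prob_space "walk_space r"
  unfolding walk_space_def by (rule step.prob_space_stream_space)

lemma sets_walk_space [measurable_cong]: "sets (walk_space r) = sets (stream_space step_space)"
  by (simp add: walk_space_def)

lemma measurable_snth_walk [measurable]: "(\<lambda>\<omega>. \<omega> !! n) \<in> walk_space r \<rightarrow>\<^sub>M step_space"
  unfolding walk_space_def by simp

lemma measurable_jump_chain [measurable]:
  "(\<lambda>\<omega>. jump_chain k \<omega> n) \<in> walk_space r \<rightarrow>\<^sub>M count_space UNIV"
proof (induction n)
  case (Suc n)
  note Suc [measurable]
  have "(\<lambda>\<omega>. fst (\<omega> !! n) i) \<in> walk_space r \<rightarrow>\<^sub>M count_space UNIV" for i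
  proof -
    have "(\<lambda>\<omega>. fst (\<omega> !! n)) \<in> walk_space r \<rightarrow>\<^sub>M measure_pmf (Pi_pmf UNIV undefined (jump_pmf r))"
      by measurable
    from measurable_compose[OF this, of "\<lambda>f. f i" "count_space UNIV"] show ?thesis
      by simp
  qed
  \<comment> \<open>The random map is evaluated at a random site; with countably many sites,
    measurability at each fixed site is enough.\<close>
  from measurable_compose_countable[OF this Suc] show ?case
    by simp
qed simp

lemma measurable_holding [measurable]: "(\<lambda>\<omega>. snd (\<omega> !! n)) \<in> borel_measurable (walk_space r)"
proof -
  have "(\<lambda>\<omega>. snd (\<omega> !! n)) \<in> walk_space r \<rightarrow>\<^sub>M density lborel (exponential_density 1)"
    by measurable
  then show ?thesis
    by (simp cong: measurable_cong_sets)
qed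

lemma AE_holding_pos: "AE \<omega> in walk_space r. \<forall>n. 0 < snd (\<omega> !! n)"
proof -
  have meas [measurable]: "snd \<in> borel_measurable step_space"
    using measurable_snd[of "measure_pmf (Pi_pmf UNIV undefined (jump_pmf r))"
        "density lborel (exponential_density 1)"]
    by (simp cong: measurable_cong_sets)
  interpret holding: prob_space "density lborel (exponential_density 1)"
    by (rule prob_space_holding)
  interpret pair_sigma_finite "measure_pmf (Pi_pmf UNIV undefined (jump_pmf r))"
      "density lborel (exponential_density 1)"
    by unfold_locales
  have "AE e in density lborel (exponential_density 1). 0 < e"
    by (subst AE_density) (auto simp: exponential_density_def less_le intro: AE_mp[OF AE_lborel_singleton[of 0]])
  then have "AE x in step_space. 0 < snd x"
    by (intro AE_pair_measure) auto
  then have "AE \<omega> in walk_space r. stream_all (\<lambda>x. 0 < snd x) \<omega>"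
    unfolding walk_space_def by (intro step.AE_stream_all) auto
  then show ?thesis
    unfolding stream_all_def .
qed

lemma jump_chain_Stream_Suc: "jump_chain k (x ## \<omega>) (Suc n) = jump_chain (fst x k) \<omega> n"
  by (induction n) auto

text \<open>The stream splits into its first entry and an independent copy of itself. Of the first
  entry only the value of the random map at \<open>k\<close> matters, and its law is the marginal
  \<open>jump_pmf r k\<close>.\<close>

lemma prob_first_step:
  assumes [measurable]: "\<And>l. Measurable.pred (walk_space r) (H l)"
    and step: "\<And>x \<omega>. H k (x ## \<omega>) \<longleftrightarrow> H (fst x k) \<omega>"
  shows "walk.prob {\<omega> \<in> space (walk_space r). H k \<omega>} =
    (\<Sum>l\<in>UNIV. p k l * walk.prob {\<omega> \<in> space (walk_space r). H l \<omega>})"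
proof -
  define q where "q l = emeasure (walk_space r) {\<omega> \<in> space (walk_space r). H l \<omega>}" for l
  interpret holding: prob_space "density lborel (exponential_density 1)"
    by (rule prob_space_holding)
  let ?F = "measure_pmf (Pi_pmf UNIV undefined (jump_pmf r))"
  have "q k = (\<integral>\<^sup>+x. emeasure (walk_space r) {\<omega> \<in> space (walk_space r).
      x ## \<omega> \<in> {\<omega> \<in> space (walk_space r). H k \<omega>}} \<partial>step_space)"
    unfolding q_def walk_space_def
    by (rule step.emeasure_stream_space) (use assms(1)[of k] in \<open>simp add: walk_space_def\<close>)
  also have "\<dots> = (\<integral>\<^sup>+x. q (fst x k) \<partial>step_space)"
    unfolding q_def
    by (intro nn_integral_cong arg_cong[where f = "emeasure _"])
       (auto simp: step walk_space_def space_stream_space streams_Stream)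
  also have "\<dots> = (\<integral>\<^sup>+f. q (f k) \<partial>distr step_space ?F fst)"
    by (subst nn_integral_distr) auto
  also have "\<dots> = (\<integral>\<^sup>+f. q (f k) \<partial>?F)"
    by (simp add: holding.distr_pair_fst)
  also have "\<dots> = (\<integral>\<^sup>+l. q l \<partial>map_pmf (\<lambda>f. f k) (Pi_pmf UNIV undefined (jump_pmf r)))"
    by simp
  also have "\<dots> = (\<integral>\<^sup>+l. q l \<partial>jump_pmf r k)"
    by (subst Pi_pmf_component) auto
  also have "\<dots> = (\<Sum>l\<in>UNIV. q l * ennreal (p k l))"
    by (subst nn_integral_measure_pmf_support[of UNIV]) (auto simp: pmf_jump_pmf)
  finally show ?thesis
    unfolding q_def walk.emeasure_eq_measure
    by (simp add: sum_ennreal jump_prob_nonneg sum_nonneg mult.commute flip: ennreal_mult)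
qed


text \<open>For \<open>j \<in> C\<close> this is the event in \<open>first_hit_prob\<close> up to a
  null set, stripped of the holding times so that first-step analysis applies.\<close>

definition hits_first :: "'v set \<Rightarrow> 'v \<Rightarrow> 'v \<Rightarrow> (('v \<Rightarrow> 'v) \<times> real) stream \<Rightarrow> bool" where
  "hits_first C j k \<omega> \<longleftrightarrow>
     (\<exists>n. jump_chain k \<omega> n = j \<and> (\<forall>m<n. jump_chain k \<omega> m \<notin> C))"

lemma measurable_hits_first [measurable]: "Measurable.pred (walk_space r) (hits_first C j k)"
  unfolding hits_first_def by measurable

lemma hits_first_start: "k \<in> C \<Longrightarrow> hits_first C j k \<omega> \<longleftrightarrow> k = j"
  unfolding hits_first_def by (metis gr0I jump_chain.simps(1) not_less_zero)

lemma hits_first_Stream: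
  assumes "k \<notin> C" "j \<in> C"
  shows "hits_first C j k (x ## \<omega>) \<longleftrightarrow> hits_first C j (fst x k) \<omega>"
proof -
  have "n \<noteq> 0" if "jump_chain k (x ## \<omega>) n = j" for n
    using that assms by (cases n) auto
  then have "hits_first C j k (x ## \<omega>) \<longleftrightarrow>
      (\<exists>n. jump_chain k (x ## \<omega>) (Suc n) = j \<and> (\<forall>m<Suc n. jump_chain k (x ## \<omega>) m \<notin> C))"
    unfolding hits_first_def by (metis not0_implies_Suc)
  also have "\<dots> \<longleftrightarrow> hits_first C j (fst x k) \<omega>"
    using assms by (simp add: hits_first_def All_less_Suc2 jump_chain_Stream_Suc del: jump_chain.simps(2))
  finally show ?thesis .
qed

text \<open>The probability of never meeting \<open>C\<close> is harmonic off \<open>C\<close> and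
  zero on \<open>C\<close>, so the maximum principle makes it zero.\<close>

lemma AE_jump_chain_hits:
  assumes "C \<noteq> {}"
  shows "AE \<omega> in walk_space r. \<exists>n. jump_chain k \<omega> n \<in> C"
proof -
  define H where "H l \<omega> \<longleftrightarrow> (\<forall>n. jump_chain l \<omega> n \<notin> C)" for l and \<omega> :: "(('v \<Rightarrow> 'v) \<times> real) stream"
  have [measurable]: "Measurable.pred (walk_space r) (H l)" for l
    unfolding H_def by measurable
  have H_step: "H l (x ## \<omega>) \<longleftrightarrow> H (fst x l) \<omega>" if "l \<notin> C" for l x \<omega>
    using that unfolding H_def by (metis jump_chain.simps(1) jump_chain_Stream_Suc not0_implies_Suc)
  have H_start: "\<not> H l \<omega>" if "l \<in> C" for l \<omega>
    using that unfolding H_def by (metis jump_chain.simps(1))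
  have "walk.prob {\<omega> \<in> space (walk_space r). H k \<omega>} \<le> 0"
  proof (rule subharmonic_nonpos[OF assms, of "\<lambda>l. walk.prob {\<omega> \<in> space (walk_space r). H l \<omega>}"])
    show "walk.prob {\<omega> \<in> space (walk_space r). H l \<omega>} \<le> 0" if "l \<in> C" for l
      by (simp add: H_start that)
    show "walk.prob {\<omega> \<in> space (walk_space r). H l \<omega>} \<le>
        (\<Sum>m\<in>UNIV. p l m * walk.prob {\<omega> \<in> space (walk_space r). H m \<omega>})" if "l \<notin> C" for l
      by (rule eq_refl, rule prob_first_step) (simp_all add: H_step that)
  qed
  then have "walk.prob {\<omega> \<in> space (walk_space r). H k \<omega>} = 0"
    by (simp add: measure_le_0_iff)
  then have "AE \<omega> in walk_space r. \<not> H k \<omega>"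
    by (subst (asm) walk.prob_eq_0) auto
  then show ?thesis
    by (simp add: H_def)
qed

section \<open>Hitting times in terms of the jump chain\<close>

lemma jump_time_Suc:
  "jump_time r k \<omega> (Suc n) = jump_time r k \<omega> n + snd (\<omega> !! n) / out_rate r (jump_chain k \<omega> n)"
  by (simp add: jump_time_def)

lemma strict_mono_jump_time:
  assumes "\<And>n. 0 < snd (\<omega> !! n)"
  shows "strict_mono (jump_time r k \<omega>)"
  using assms out_rate_gt_0 by (intro strict_monoI_Suc) (simp add: jump_time_Suc)

lemma walk_jump_time:
  assumes "\<And>n. 0 < snd (\<omega> !! n)"
  shows "walk r k \<omega> (jump_time r k \<omega> n) = jump_chain k \<omega> n"
proof -
  have "(LEAST m. jump_time r k \<omega> n < jump_time r k \<omega> (Suc m)) = n"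
    using strict_mono_jump_time[OF assms]
    by (intro Least_equality) (auto simp: strict_mono_less)
  then show ?thesis
    by (simp add: walk_def)
qed

lemma walk_before_jump_time:
  assumes "0 \<le> t" "t < jump_time r k \<omega> n"
  obtains m where "m < n" "walk r k \<omega> t = jump_chain k \<omega> m"
proof -
  obtain m where m: "n = Suc m"
    using assms by (cases n) (auto simp: jump_time_def)
  then have "(LEAST m. t < jump_time r k \<omega> (Suc m)) \<le> m"
    using assms by (intro Least_le) auto
  with that m show thesis
    by (simp add: walk_def less_Suc_eq_le)
qed

lemma hitting_time_ge:
  assumes "\<And>m. m < n \<Longrightarrow> jump_chain k \<omega> m \<notin> B"
  shows "jump_time r k \<omega> n \<le> hitting_time r k B \<omega>"
  unfolding hitting_time_def
proof (rule INF_greatest)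
  fix t assume "t \<in> {t. 0 \<le> t \<and> walk r k \<omega> t \<in> B}"
  then have "\<not> t < jump_time r k \<omega> n"
    using assms walk_before_jump_time[of t k \<omega> n] by (metis mem_Collect_eq)
  then show "ereal (jump_time r k \<omega> n) \<le> ereal t"
    by simp
qed

lemma hitting_time_eq:
  assumes "\<And>n. 0 < snd (\<omega> !! n)"
    and "\<And>m. m < n \<Longrightarrow> jump_chain k \<omega> m \<notin> B" "jump_chain k \<omega> n \<in> B"
  shows "hitting_time r k B \<omega> = jump_time r k \<omega> n"
proof (rule antisym)
  have "jump_time r k \<omega> 0 \<le> jump_time r k \<omega> n"
    using strict_mono_jump_time[OF assms(1)] by (simp add: strict_mono_less_eq)
  then show "hitting_time r k B \<omega> \<le> jump_time r k \<omega> n"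
    unfolding hitting_time_def
    by (intro INF_lower) (use assms(3) in \<open>simp add: walk_jump_time[OF assms(1)] jump_time_def[where n = 0]\<close>)
qed (use assms hitting_time_ge in auto)

text \<open>Let \<open>n\<close> be the step of first entrance into \<open>C\<close>. If it happens
  at \<open>j\<close>, both hitting times equal the \<open>n\<close>-th jump time; otherwise
  \<open>j\<close> is not visited before step \<open>n + 1\<close>, which comes strictly later
  because holding times are positive.\<close>

lemma hitting_time_eq_iff_hits_first:
  assumes pos: "\<And>n. 0 < snd (\<omega> !! n)" and hit: "\<exists>n. jump_chain k \<omega> n \<in> C" and "j \<in> C"
  shows "hitting_time r k C \<omega> = hitting_time r k {j} \<omega> \<longleftrightarrow> hits_first C j k \<omega>"
proof -
  obtain n where n: "jump_chain k \<omega> n \<in> C" "\<And>m. m < n \<Longrightarrow> jump_chain k \<omega> m \<notin> C"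
    using exists_least_iff[of "\<lambda>n. jump_chain k \<omega> n \<in> C"] hit by auto
  have T: "hitting_time r k C \<omega> = jump_time r k \<omega> n"
    using n by (intro hitting_time_eq pos)
  show ?thesis
  proof (cases "jump_chain k \<omega> n = j")
    case True
    then have "hitting_time r k {j} \<omega> = jump_time r k \<omega> n"
      using n \<open>j \<in> C\<close> by (intro hitting_time_eq pos) force+
    with True n T show ?thesis
      by (auto simp: hits_first_def)
  next
    case False
    have "jump_time r k \<omega> (Suc n) \<le> hitting_time r k {j} \<omega>"
      using n \<open>j \<in> C\<close> False by (intro hitting_time_ge) (auto simp: less_Suc_eq)
    moreover have "jump_time r k \<omega> n < jump_time r k \<omega> (Suc n)"
      using strict_mono_jump_time[OF pos] by (simp add: strict_mono_less)
    ultimately have "hitting_time r k C \<omega> \<noteq> hitting_time r k {j} \<omega>"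
      unfolding T by (metis ereal_less_eq(3) leD)
    moreover have "\<not> hits_first C j k \<omega>"
    proof
      assume "hits_first C j k \<omega>"
      then obtain m where "jump_chain k \<omega> m = j" "\<forall>m'<m. jump_chain k \<omega> m' \<notin> C"
        by (auto simp: hits_first_def)
      then show False
        using n False \<open>j \<in> C\<close> by (cases m n rule: linorder_cases) auto
    qed
    ultimately show ?thesis
      by simp
  qed
qed

text \<open>This holds also for an exploding sequence of jump times, where the walk is constant from the
  explosion time on.\<close>

lemma walk_right_constant:
  "\<exists>e>0. \<forall>s. t \<le> s \<and> s < t + e \<longrightarrow> walk r k \<omega> s = walk r k \<omega> t"
proof (cases "\<exists>n. t < jump_time r k \<omega> (Suc n)")
  case True
  define n where "n = (LEAST n. t < jump_time r k \<omega> (Suc n))"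
  have n: "t < jump_time r k \<omega> (Suc n)"
    unfolding n_def by (rule LeastI_ex[OF True])
  have const: "walk r k \<omega> s = walk r k \<omega> t" if "t \<le> s" "s < jump_time r k \<omega> (Suc n)" for s
  proof -
    have "(LEAST n. s < jump_time r k \<omega> (Suc n)) = n"
    proof (rule Least_equality)
      show "n \<le> m" if "s < jump_time r k \<omega> (Suc m)" for m
        unfolding n_def by (rule Least_le) (use \<open>t \<le> s\<close> that in simp)
    qed fact
    then show ?thesis
      by (simp add: walk_def n_def)
  qed
  show ?thesis
  proof (intro exI conjI allI impI)
    show "0 < jump_time r k \<omega> (Suc n) - t"
      using n by simp
    show "walk r k \<omega> s = walk r k \<omega> t" if "t \<le> s \<and> s < t + (jump_time r k \<omega> (Suc n) - t)" for s
      by (rule const) (use that in auto)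
  qed
next
  case False
  have "walk r k \<omega> s = walk r k \<omega> t" if "t \<le> s" for s
  proof -
    have "\<not> s < jump_time r k \<omega> (Suc n)" "\<not> t < jump_time r k \<omega> (Suc n)" for n
      using False that by (meson order_le_less_trans)+
    then show ?thesis
      by (simp add: walk_def)
  qed
  then show ?thesis
    by (blast intro: zero_less_one)
qed

text \<open>The walk is right-constant, so rational times shortly after a visit to \<open>B\<close>
  are visits too. The infimum over a countable set gives measurability of the hitting time.\<close>

lemma hitting_time_rat:
  "hitting_time r k B \<omega> =
     (INF q\<in>{q. 0 \<le> q}. if walk r k \<omega> (of_rat q) \<in> B then ereal (of_rat q) else \<infinity>)"
proof (rule antisym)
  have "hitting_time r k B \<omega> \<le> ereal (of_rat q)" if "walk r k \<omega> (of_rat q) \<in> B" "0 \<le> q" for q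
    unfolding hitting_time_def by (rule INF_lower) (use that in simp)
  then show "hitting_time r k B \<omega> \<le>
     (INF q\<in>{q. 0 \<le> q}. if walk r k \<omega> (of_rat q) \<in> B then ereal (of_rat q) else \<infinity>)"
    by (intro INF_greatest) simp
  show "(INF q\<in>{q. 0 \<le> q}. if walk r k \<omega> (of_rat q) \<in> B then ereal (of_rat q) else \<infinity>)
      \<le> hitting_time r k B \<omega>" (is "?I \<le> _")
    unfolding hitting_time_def
  proof (rule INF_greatest)
    fix t assume t: "t \<in> {t. 0 \<le> t \<and> walk r k \<omega> t \<in> B}"
    obtain e where e: "e > 0" "\<And>s. t \<le> s \<Longrightarrow> s < t + e \<Longrightarrow> walk r k \<omega> s = walk r k \<omega> t"
      using walk_right_constant by blast
    have "?I \<le> ereal t + ereal d" if "d > 0" for d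
    proof -
      obtain q where q: "t < of_rat q" "of_rat q < t + min d e"
        using of_rat_dense[of t "t + min d e"] \<open>d > 0\<close> \<open>e > 0\<close> by fastforce
      have "walk r k \<omega> (of_rat q) \<in> B"
      proof -
        have "walk r k \<omega> (of_rat q) = walk r k \<omega> t"
          by (rule e(2)) (use q in linarith)+
        then show ?thesis
          using t by simp
      qed
      moreover have "0 \<le> (of_rat q :: real)"
        using t q(1) by (simp del: zero_le_of_rat_iff)
      then have "0 \<le> q"
        by simp
      ultimately have "?I \<le> ereal (of_rat q)"
        by (intro INF_lower2[of q]) simp_all
      also have "\<dots> \<le> ereal t + ereal d"
        using q by simp
      finally show ?thesis .
    qed
    then show "?I \<le> ereal t"
      by (rule ereal_le_epsilon2)
  qed
qed

lemma measurable_jump_time [measurable]: "(\<lambda>\<omega>. jump_time r k \<omega> n) \<in> borel_measurable (walk_space r)"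
proof -
  have [measurable]: "(\<lambda>\<omega>. out_rate r (jump_chain k \<omega> m)) \<in> borel_measurable (walk_space r)" for m
    by (rule measurable_compose[OF measurable_jump_chain]) simp
  show ?thesis
    unfolding jump_time_def by measurable
qed

lemma measurable_walk [measurable]: "(\<lambda>\<omega>. walk r k \<omega> t) \<in> walk_space r \<rightarrow>\<^sub>M count_space UNIV"
  unfolding walk_def
  by (rule measurable_compose_countable[OF measurable_jump_chain]) measurable

lemma measurable_hitting_time [measurable]:
  "hitting_time r k B \<in> borel_measurable (walk_space r)"
  unfolding hitting_time_rat[abs_def] by measurable

section \<open>First-hit probabilities as harmonic functions\<close>

lemma first_hit_prob_eq:
  assumes "j \<in> C"
  shows "first_hit_prob r C k j = walk.prob {\<omega> \<in> space (walk_space r). hits_first C j k \<omega>}"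
  unfolding first_hit_prob_def
proof (rule walk.finite_measure_eq_AE)
  have "C \<noteq> {}"
    using assms by auto
  \<comment> \<open>Outside a null set the chain meets \<open>C\<close> and all holding times are
    positive, and there the two events coincide.\<close>
  from AE_jump_chain_hits[OF this, of k] AE_holding_pos
  show "AE \<omega> in walk_space r.
      \<omega> \<in> {\<omega> \<in> space (walk_space r). hitting_time r k C \<omega> = hitting_time r k {j} \<omega>} \<longleftrightarrow>
      \<omega> \<in> {\<omega> \<in> space (walk_space r). hits_first C j k \<omega>}"
    by eventually_elim (use hitting_time_eq_iff_hits_first assms in simp)
qed measurable

lemma first_hit_prob_boundary:
  assumes "j \<in> C" "k \<in> C"
  shows "first_hit_prob r C k j = of_bool (k = j)"
  by (simp add: first_hit_prob_eq hits_first_start assms walk.prob_space)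

lemma first_hit_prob_harmonic:
  assumes "j \<in> C" "k \<notin> C"
  shows "first_hit_prob r C k j = (\<Sum>l\<in>UNIV. p k l * first_hit_prob r C l j)"
  unfolding first_hit_prob_eq[OF assms(1)]
  by (rule prob_first_step) (use assms hits_first_Stream in auto)

lemma first_hit_prob_nonneg: "0 \<le> first_hit_prob r C k j"
  by (simp add: first_hit_prob_def)

lemma first_hit_prob_le_1: "first_hit_prob r C k j \<le> 1"
  by (simp add: first_hit_prob_def)

text \<open>The sum and the constant 1 agree on \<open>C\<close> and are both harmonic off
  it.\<close>

lemma sum_first_hit_prob:
  assumes "C \<noteq> {}"
  shows "(\<Sum>j\<in>C. first_hit_prob r C k j) = 1"
proof (rule harmonic_unique[OF assms])
  show "(\<Sum>j\<in>C. first_hit_prob r C k j) = 1" if "k \<in> C" for k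
    using that by (simp add: first_hit_prob_boundary)
  show "(\<Sum>j\<in>C. first_hit_prob r C k j) - (\<Sum>l\<in>UNIV. p k l * (\<Sum>j\<in>C. first_hit_prob r C l j))
      = 1 - (\<Sum>l\<in>UNIV. p k l * 1)" if "k \<notin> C" for k
  proof -
    have "(\<Sum>l\<in>UNIV. p k l * (\<Sum>j\<in>C. first_hit_prob r C l j)) =
        (\<Sum>j\<in>C. \<Sum>l\<in>UNIV. p k l * first_hit_prob r C l j)"
      by (simp only: sum_distrib_left sum.swap[of _ C])
    then show ?thesis
      using that by (simp add: sum_jump_prob first_hit_prob_harmonic)
  qed
qed

section \<open>The Green function of the walk killed in a set\<close>

text \<open>Summation by parts turns the pairing of the drift with the first-hit function
  \<open>h\<close> into the total of \<open>L\<close>, the generator applied to \<open>h\<close>.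
  \<open>L\<close> vanishes off \<open>insert j A\<close>, gives the trace rates into
  \<open>j\<close> on \<open>A\<close>, and at \<open>j\<close> minus the total trace rate out of
  \<open>j\<close>.\<close>

lemma trace_drift_eq:
  assumes "j \<notin> A"
  shows "trace_drift r (insert j A) j =
    (\<Sum>k\<in>UNIV. drift r $ k * first_hit_prob r (insert j A) k j)"
proof -
  define C where "C = insert j A"
  define h where "h k = first_hit_prob r C k j" for k
  define L where "L i = (\<Sum>k\<in>UNIV. r i k * h k) - out_rate r i * h i" for i
  have hj: "h j = 1" and hA: "\<And>k. k \<in> A \<Longrightarrow> h k = 0"
    using assms by (auto simp: h_def C_def first_hit_prob_boundary)
  have split: "(\<Sum>k\<in>UNIV. f k) = f j + (\<Sum>k\<in>A. f k) + (\<Sum>k\<in>-C. f k)" for f :: "'v \<Rightarrow> real"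
  proof -
    have "(\<Sum>k\<in>UNIV. f k) = (\<Sum>k\<in>C. f k) + (\<Sum>k\<in>-C. f k)"
      by (subst sum.union_disjoint[symmetric]) auto
    then show ?thesis
      using assms by (simp add: C_def)
  qed
  have "(\<Sum>k\<in>UNIV. drift r $ k * h k) = (\<Sum>k\<in>UNIV. \<Sum>i\<in>UNIV. r i k * h k - r k i * h k)"
    by (simp add: drift_def sum_distrib_right left_diff_distrib)
  also have "\<dots> = (\<Sum>k\<in>UNIV. \<Sum>i\<in>UNIV. r i k * h k) - (\<Sum>k\<in>UNIV. \<Sum>i\<in>UNIV. r k i * h k)"
    by (simp add: sum_subtractf)
  also have "\<dots> = (\<Sum>i\<in>UNIV. L i)"
    by (subst sum.swap) (simp add: L_def out_rate_def sum_distrib_right sum_subtractf)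
  also have "\<dots> = L j + (\<Sum>i\<in>A. L i)"
  proof -
    have "L i = 0" if "i \<notin> C" for i
      using first_hit_prob_harmonic[of j C i] that
      by (simp add: L_def h_def C_def rate_eq mult.assoc flip: sum_distrib_left)
    then show ?thesis
      by (simp add: split)
  qed
  also have "L j = - (\<Sum>i\<in>A. trace_rate r C j i)"
  proof -
    have "(\<Sum>i\<in>A. trace_rate r C j i) =
        (\<Sum>i\<in>A. r j i) + (\<Sum>i\<in>A. \<Sum>k\<in>-C. r j k * first_hit_prob r C k i)"
      unfolding trace_rate_def sum.distrib[symmetric] using assms by (intro sum.cong) auto
    also have "(\<Sum>i\<in>A. \<Sum>k\<in>-C. r j k * first_hit_prob r C k i) =
        (\<Sum>k\<in>-C. r j k * (\<Sum>i\<in>A. first_hit_prob r C k i))"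
      by (subst sum.swap) (simp add: sum_distrib_left)
    \<comment> \<open>The walk enters \<open>C\<close> at \<open>j\<close> or in \<open>A\<close>,
      with probabilities adding up to 1.\<close>
    also have "\<dots> = (\<Sum>k\<in>-C. r j k * (1 - h k))"
    proof -
      have "(\<Sum>i\<in>A. first_hit_prob r C k i) = 1 - h k" for k
        using sum_first_hit_prob[of C k] assms by (simp add: C_def h_def)
      then show ?thesis
        by simp
    qed
    finally show ?thesis
      by (simp add: L_def split out_rate_def hj hA right_diff_distrib sum_subtractf)
  qed
  also have "(\<Sum>i\<in>A. L i) = (\<Sum>i\<in>A. trace_rate r C i j)"
  proof (intro sum.cong refl)
    fix i assume "i \<in> A"
    then show "L i = trace_rate r C i j"
      using assms by (auto simp: L_def split hj hA trace_rate_def simp flip: h_def)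
  qed
  finally show ?thesis
    using assms by (simp add: trace_drift_def sum_subtractf trace_rate_def C_def h_def)
qed

text \<open>The denominator is the probability that the walk started at \<open>j\<close> visits \<open>A\<close> before it
  returns to \<open>j\<close>, so this is the expected number of visits to \<open>j\<close> before \<open>A\<close> of the jump chain
  started at \<open>k\<close>.\<close>

definition green :: "'v set \<Rightarrow> 'v \<Rightarrow> 'v \<Rightarrow> real" where
  "green A k j = first_hit_prob r (insert j A) k j /
     (1 - (\<Sum>l\<in>UNIV. p j l * first_hit_prob r (insert j A) l j))"

text \<open>If return to \<open>j\<close> before \<open>A\<close> were certain, the hitting function
  would be subharmonic at \<open>j\<close> as well, hence nonpositive everywhere, yet it is 1 at
  \<open>j\<close>.\<close>

lemma escape_prob_pos:
  assumes "A \<noteq> {}" "j \<notin> A"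
  shows "0 < 1 - (\<Sum>l\<in>UNIV. p j l * first_hit_prob r (insert j A) l j)"
proof -
  let ?h = "\<lambda>k. first_hit_prob r (insert j A) k j"
  have "(\<Sum>l\<in>UNIV. p j l * ?h l) \<le> (\<Sum>l\<in>UNIV. p j l * 1)"
    by (intro sum_mono mult_left_mono first_hit_prob_le_1 jump_prob_nonneg)
  moreover have "(\<Sum>l\<in>UNIV. p j l * ?h l) \<noteq> 1"
  proof
    assume return: "(\<Sum>l\<in>UNIV. p j l * ?h l) = 1"
    have "?h j \<le> 0"
    proof (rule subharmonic_nonpos[OF \<open>A \<noteq> {}\<close>, of ?h])
      show "?h k \<le> 0" if "k \<in> A" for k
        using that \<open>j \<notin> A\<close> by (auto simp: first_hit_prob_boundary)
      show "?h k \<le> (\<Sum>l\<in>UNIV. p k l * ?h l)" if "k \<notin> A" for k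
        using that return first_hit_prob_harmonic[of j "insert j A" k] first_hit_prob_le_1
        by (cases "k = j") auto
    qed
    then show False
      by (simp add: first_hit_prob_boundary)
  qed
  ultimately show ?thesis
    by (simp add: sum_jump_prob)
qed

lemma green_nonneg:
  assumes "A \<noteq> {}" "j \<notin> A"
  shows "0 \<le> green A k j"
  using escape_prob_pos[OF assms] first_hit_prob_nonneg by (simp add: green_def)

lemma green_killed:
  assumes "j \<notin> A" "k \<in> A"
  shows "green A k j = 0"
  using assms by (auto simp: green_def first_hit_prob_boundary)

text \<open>The hitting function in the numerator is harmonic off \<open>insert j A\<close>. At
  \<open>j\<close> it fails to be so by exactly the escape probability, and division by that makes
  the defect 1.\<close>

lemma green_first_step:
  assumes "A \<noteq> {}" "j \<notin> A" "k \<notin> A"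
  shows "green A k j = of_bool (k = j) + (\<Sum>l\<in>UNIV. p k l * green A l j)"
proof -
  let ?h = "\<lambda>k. first_hit_prob r (insert j A) k j"
  have "?h k = of_bool (k = j) * (1 - (\<Sum>l\<in>UNIV. p j l * ?h l)) + (\<Sum>l\<in>UNIV. p k l * ?h l)"
    using assms first_hit_prob_harmonic[of j "insert j A" k]
    by (cases "k = j") (auto simp: first_hit_prob_boundary)
  then show ?thesis
    using escape_prob_pos[OF assms(1,2)]
    by (simp add: green_def add_divide_distrib flip: sum_divide_distrib)
qed

text \<open>This is \<open>G = I + G P\<close>, against \<open>G = I + P G\<close> above. Both sides
  vanish on \<open>A\<close> and, by the first-step identity, have the same defect
  \<open>of_bool (k = i)\<close> from harmonicity off \<open>A\<close>.\<close>

lemma green_last_step: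
  assumes "A \<noteq> {}" "i \<notin> A"
  shows "green A k i = of_bool (k = i) + (\<Sum>j\<in>-A. green A k j * p j i)" (is "_ = ?g k")
proof (rule harmonic_unique[OF \<open>A \<noteq> {}\<close>, where g = "\<lambda>k. green A k i" and g' = ?g])
  show "green A k i = ?g k" if "k \<in> A" for k
    using that assms(2) by (auto simp: green_killed)
  show "green A k i - (\<Sum>l\<in>UNIV. p k l * green A l i) = ?g k - (\<Sum>l\<in>UNIV. p k l * ?g l)"
    if "k \<notin> A" for k
  proof -
    have "(\<Sum>l\<in>UNIV. p k l * of_bool (l = i)) = p k i"
      by (simp add: of_bool_def if_distrib[where f = "(*) _"] cong: if_cong)
    then have "(\<Sum>l\<in>UNIV. p k l * ?g l) =
        p k i + (\<Sum>l\<in>UNIV. \<Sum>j\<in>-A. p k l * green A l j * p j i)"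
      by (simp add: distrib_left sum.distrib sum_distrib_left mult.assoc)
    also have "(\<Sum>l\<in>UNIV. \<Sum>j\<in>-A. p k l * green A l j * p j i) =
        (\<Sum>j\<in>-A. (\<Sum>l\<in>UNIV. p k l * green A l j) * p j i)"
      by (subst sum.swap) (simp add: sum_distrib_right)
    also have "\<dots> = (\<Sum>j\<in>-A. (green A k j - of_bool (k = j)) * p j i)"
      using that assms(1) by (intro sum.cong) (auto simp: green_first_step)
    also have "\<dots> = (\<Sum>j\<in>-A. green A k j * p j i) - p k i"
      using that by (simp add: left_diff_distrib sum_subtractf of_bool_def if_distrib[where f = "\<lambda>x. x * p _ i"] cong: if_cong)
    finally show ?thesis
      using that assms green_first_step[of A i k] by simp
  qed
qed

text \<open>The trace drift is the pairing of the drift with the Green function times a positive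
  escape probability, so the signs agree. For \<open>A = UNIV\<close> the right side is
  vacuous.\<close>

lemma absorbing_iff_green:
  assumes "A \<noteq> {}"
  shows "absorbing r A \<longleftrightarrow> (\<forall>j\<in>-A. (\<Sum>k\<in>UNIV. drift r $ k * green A k j) \<le> 0)"
proof -
  have "trace_drift r (insert j A) j \<le> 0 \<longleftrightarrow> (\<Sum>k\<in>UNIV. drift r $ k * green A k j) \<le> 0"
    if "j \<in> -A" for j
    using escape_prob_pos[of A j] that assms
    by (simp add: trace_drift_eq green_def divide_le_0_iff flip: sum_divide_distrib)
  then show ?thesis
    by (auto simp: absorbing_def)
qed

end

section \<open>Paths that increase only on a given set\<close>

lemma increase_set_zero:
  fixes \<phi> :: "real \<Rightarrow> real"
  assumes "\<And>t. 0 \<le> t \<Longrightarrow> \<phi> t = (LINT s:{0<..t}|M. indicat_real S s)"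
  shows "\<phi> 0 = 0"
  using assms[of 0] by (simp add: set_lebesgue_integral_def)

text \<open>\<open>S\<close> need not be measurable: if the integral up to \<open>t\<close> does not exist, it is 0 in
  Isabelle, and then so is \<open>\<phi>\<close> on \<open>[0, t]\<close> by monotonicity.\<close>

lemma increase_set_cases:
  fixes \<phi> :: "real \<Rightarrow> real"
  assumes mono: "mono_on {0..} \<phi>"
    and \<phi>: "\<And>t. 0 \<le> t \<Longrightarrow> \<phi> t = (LINT s:{0<..t}|M. indicat_real S s)"
    and "0 \<le> t"
  obtains "set_integrable M {0<..t} (indicat_real S)" | "\<And>s. 0 \<le> s \<Longrightarrow> s \<le> t \<Longrightarrow> \<phi> s = 0"
proof (cases "set_integrable M {0<..t} (indicat_real S)")
  case False
  have "\<phi> 0 = 0"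
    by (rule increase_set_zero) (rule \<phi>)
  moreover have "\<phi> t = 0"
    using False \<phi>[OF \<open>0 \<le> t\<close>]
    by (simp add: set_lebesgue_integral_def set_integrable_def not_integrable_integral_eq)
  ultimately have "\<phi> s = 0" if "0 \<le> s" "s \<le> t" for s
    using mono_onD[OF mono, of 0 s] mono_onD[OF mono, of s t] that by simp
  then show thesis
    by (rule that(2))
qed (rule that(1))

lemma increase_set_flat:
  fixes \<phi> :: "real \<Rightarrow> real"
  assumes mono: "mono_on {0..} \<phi>" and borel: "sets M = sets borel"
    and \<phi>: "\<And>t. 0 \<le> t \<Longrightarrow> \<phi> t = (LINT s:{0<..t}|M. indicat_real S s)"
    and st: "0 \<le> s" "s \<le> t" and out: "\<And>x. s < x \<Longrightarrow> x \<le> t \<Longrightarrow> x \<notin> S"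
  shows "\<phi> t = \<phi> s"
proof -
  have "0 \<le> t"
    using st by simp
  show ?thesis
  proof (rule increase_set_cases[OF mono \<phi> \<open>0 \<le> t\<close>])
    assume int: "set_integrable M {0<..t} (indicat_real S)"
    have meas: "{0<..s} \<in> sets M" "{s<..t} \<in> sets M"
      by (simp_all add: borel)
    have "{0<..t} = {0<..s} \<union> {s<..t}"
      using st by auto
    moreover have "(LINT x:{0<..s} \<union> {s<..t}|M. indicat_real S x) =
        (LINT x:{0<..s}|M. indicat_real S x) + (LINT x:{s<..t}|M. indicat_real S x)"
    proof (rule set_integral_Un)
      show "set_integrable M {0<..s} (indicat_real S)" "set_integrable M {s<..t} (indicat_real S)"
        by (rule set_integrable_subset[OF int]; use meas st in auto)+
    qed auto
    moreover have "(LINT x:{s<..t}|M. indicat_real S x) = (LINT x:{s<..t}|M. 0)"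
      by (rule set_lebesgue_integral_cong) (use out meas in auto)
    ultimately show ?thesis
      using \<phi> st by simp
  next
    assume "\<And>s. 0 \<le> s \<Longrightarrow> s \<le> t \<Longrightarrow> \<phi> s = 0"
    then show ?thesis
      using st by simp
  qed
qed

text \<open>Since \<open>a \<notin> S\<close>, the integral over \<open>{0<..a}\<close> equals that
  over \<open>{0<..<a}\<close>, the limit of the integrals over \<open>{0<..b n}\<close>; so
  \<open>\<phi>\<close> has no jump at \<open>a\<close>. If the integral does not exist,
  \<open>\<phi>\<close> is zero up to \<open>a\<close>.\<close>

lemma increase_set_left_cont:
  fixes \<phi> :: "real \<Rightarrow> real"
  assumes mono: "mono_on {0..} \<phi>" and borel: "sets M = sets borel"
    and \<phi>: "\<And>t. 0 \<le> t \<Longrightarrow> \<phi> t = (LINT s:{0<..t}|M. indicat_real S s)"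
    and "0 < a" "a \<notin> S" "0 < e"
  obtains s where "0 \<le> s" "s < a" "\<phi> a - \<phi> s < e"
proof -
  have "0 \<le> a"
    using \<open>0 < a\<close> by simp
  show thesis
  proof (rule increase_set_cases[OF mono \<phi> \<open>0 \<le> a\<close>])
    assume int': "set_integrable M {0<..a} (indicat_real S)"
    define b where "b n = a - a / (Suc n)" for n
    have b: "0 \<le> b n" "b n < a" for n
      using \<open>0 < a\<close> by (auto simp: b_def field_simps)
    have "incseq b"
      using \<open>0 < a\<close> by (intro incseq_SucI) (auto simp: b_def field_simps)
    have b_lim: "b \<longlonglongrightarrow> a"
      using tendsto_diff[OF tendsto_const tendsto_mult[OF tendsto_const LIMSEQ_inverse_real_of_nat]]
      unfolding b_def divide_inverse by fastforce
    have un: "(\<Union>n. {0<..b n}) = {0<..<a}"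
    proof (intro equalityI subsetI)
      fix x assume "x \<in> {0<..<a}"
      then obtain n where "x < b n"
        using order_tendstoD(1)[OF b_lim, of x] by (auto simp: eventually_sequentially)
      then show "x \<in> (\<Union>n. {0<..b n})"
        using \<open>x \<in> {0<..<a}\<close> by (auto intro: less_imp_le)
    qed (use b in \<open>auto intro: le_less_trans\<close>)
    have int: "set_integrable M {0<..<a} (indicat_real S)"
      by (rule set_integrable_subset[OF int']) (auto simp: borel)
    have "(\<lambda>n. LINT x:{0<..b n}|M. indicat_real S x) \<longlonglongrightarrow> (LINT x:(\<Union>n. {0<..b n})|M. indicat_real S x)"
    proof (rule set_integral_cont_up)
      show "incseq (\<lambda>n. {0<..b n})"
        using \<open>incseq b\<close> by (auto simp: incseq_def) (meson order_trans)
    qed (use int un in \<open>simp_all add: borel\<close>)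
    moreover have "(LINT x:{0<..<a}|M. indicat_real S x) = (LINT x:{0<..a}|M. indicat_real S x)"
      unfolding set_lebesgue_integral_def using \<open>a \<notin> S\<close>
      by (intro Bochner_Integration.integral_cong) (auto simp: indicator_def less_le)
    ultimately have "(\<lambda>n. \<phi> (b n)) \<longlonglongrightarrow> \<phi> a"
      using b \<open>0 < a\<close> by (simp add: \<phi> un)
    then obtain n where "\<phi> a - e < \<phi> (b n)"
      using order_tendstoD(1)[of "\<lambda>n. \<phi> (b n)" "\<phi> a" sequentially "\<phi> a - e"] \<open>0 < e\<close>
      by (auto simp: eventually_sequentially)
    then show thesis
      using b by (intro that[of "b n"]) auto
  next
    assume "\<And>s. 0 \<le> s \<Longrightarrow> s \<le> a \<Longrightarrow> \<phi> s = 0"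
    then show thesis
      using \<open>0 < a\<close> \<open>0 < e\<close> by (intro that[of 0]) auto
  qed
qed

text \<open>At its last entrance into the region where \<open>\<phi> - \<psi> > c\<close>, the path \<open>\<phi>\<close> could not jump, nor
  could it increase afterwards.\<close>

lemma increase_set_barrier:
  fixes \<phi> \<psi> :: "real \<Rightarrow> real"
  assumes mono: "mono_on {0..} \<phi>" and borel: "sets M = sets borel"
    and \<phi>: "\<And>t. 0 \<le> t \<Longrightarrow> \<phi> t = (LINT s:{0<..t}|M. indicat_real S s)"
    and mono': "mono_on {0..} \<psi>"
    and start: "\<phi> 0 - \<psi> 0 \<le> c"
    and barrier: "\<And>s. 0 \<le> s \<Longrightarrow> s \<le> t \<Longrightarrow> s \<in> S \<Longrightarrow> \<phi> s - \<psi> s \<le> c"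
    and "0 \<le> t"
  shows "\<phi> t - \<psi> t \<le> c"
proof (rule ccontr)
  assume above: "\<not> \<phi> t - \<psi> t \<le> c"
  define W where "W = {s. 0 \<le> s \<and> s \<le> t \<and> (\<forall>x. s \<le> x \<and> x \<le> t \<longrightarrow> c < \<phi> x - \<psi> x)}"
  define a where "a = Inf W"
  have "t \<in> W"
    using above \<open>0 \<le> t\<close> by (auto simp: W_def)
  have "bdd_below W"
    by (auto simp: W_def)
  have "a \<le> t"
    unfolding a_def using \<open>t \<in> W\<close> \<open>bdd_below W\<close> by (rule cInf_lower)
  have "0 \<le> a"
    unfolding a_def by (rule cInf_greatest) (use \<open>t \<in> W\<close> in \<open>auto simp: W_def\<close>)
  have after: "c < \<phi> x - \<psi> x" if "a < x" "x \<le> t" for x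
  proof -
    obtain s where "s \<in> W" "s < x"
      using \<open>a < x\<close> \<open>t \<in> W\<close> \<open>bdd_below W\<close> unfolding a_def by (subst (asm) cInf_less_iff) auto
    then show ?thesis
      using \<open>x \<le> t\<close> by (auto simp: W_def)
  qed
  have "\<phi> t = \<phi> a"
    using mono borel \<phi> \<open>0 \<le> a\<close> \<open>a \<le> t\<close>
  proof (rule increase_set_flat)
    show "x \<notin> S" if "a < x" "x \<le> t" for x
      using after[OF that] barrier[of x] that \<open>0 \<le> a\<close> by force
  qed
  moreover have "\<psi> a \<le> \<psi> t"
    using mono_onD[OF mono', of a t] \<open>0 \<le> a\<close> \<open>a \<le> t\<close> by simp
  ultimately have above_a: "c < \<phi> a - \<psi> a"
    using above by simp
  have "0 < a"
    using above_a start \<open>0 \<le> a\<close> by (cases "a = 0") auto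
  have "a \<notin> S"
    using above_a barrier[of a] \<open>0 \<le> a\<close> \<open>a \<le> t\<close> by force
  obtain s where s: "0 \<le> s" "s < a" "\<phi> a - \<phi> s < \<phi> a - \<psi> a - c"
    using increase_set_left_cont[OF mono borel \<phi> \<open>0 < a\<close> \<open>a \<notin> S\<close>, of "\<phi> a - \<psi> a - c"] above_a
    by auto
  \<comment> \<open>Going left from \<open>a\<close>, \<open>\<psi>\<close> can only drop and
    \<open>\<phi>\<close> loses less than its excess over the level, so the excess persists back to
    \<open>s\<close>, before the infimum \<open>a\<close> of \<open>W\<close>.\<close>
  have "c < \<phi> x - \<psi> x" if "s \<le> x" "x \<le> t" for x
  proof (cases "a < x")
    case False
    then have "\<phi> s \<le> \<phi> x" "\<psi> x \<le> \<psi> a"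
      using that \<open>0 \<le> s\<close> mono_onD[OF mono, of s x] mono_onD[OF mono', of x a] by auto
    then show ?thesis
      using s by simp
  qed (use after that in auto)
  then have "s \<in> W"
    using s \<open>a \<le> t\<close> by (auto simp: W_def)
  then have "a \<le> s"
    unfolding a_def using \<open>bdd_below W\<close> by (rule cInf_lower)
  then show False
    using \<open>s < a\<close> by simp
qed

section \<open>Solutions of the oblique reflection problem\<close>

lemma simplex_face_iff:
  "z \<in> simplex_face A \<longleftrightarrow> z \<in> unit_simplex \<and> (\<forall>i\<in>-A. z $ i = 0)"
proof (cases "z \<in> unit_simplex")
  case True
  have "(\<Sum>i\<in>A. z $ i) + (\<Sum>i\<in>-A. z $ i) = (\<Sum>i\<in>UNIV. z $ i)"
    by (subst sum.union_disjoint[symmetric]) auto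
  then have "(\<Sum>i\<in>A. z $ i) = 1 \<longleftrightarrow> (\<Sum>i\<in>-A. z $ i) = 0"
    using True by (auto simp: unit_simplex_def)
  also have "\<dots> \<longleftrightarrow> (\<forall>i\<in>-A. z $ i = 0)"
    using True by (intro sum_nonneg_eq_0_iff) (auto simp: unit_simplex_def)
  finally show ?thesis
    using True by (simp add: simplex_face_def)
qed (simp add: simplex_face_def)

lemma
  assumes "solves_ORP r \<xi> Z R"
  shows solves_ORP_cadlag: "cadlag Z"
    and solves_ORP_mono: "mono_on {0..} (\<lambda>t. R t $ i)"
    and solves_ORP_increase: "\<And>t. 0 \<le> t \<Longrightarrow> R t $ i =
      (LINT s:{0<..t}|interval_measure (\<lambda>s. R (max 0 s) $ i). indicat_real {s. Z s $ i = 0} s)"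
    and solves_ORP_eq: "\<And>t. 0 \<le> t \<Longrightarrow> Z t = \<xi> t + (\<Sum>i\<in>UNIV. R t $ i *\<^sub>R reflection r i)"
    and solves_ORP_nonneg: "\<And>t. 0 \<le> t \<Longrightarrow> 0 \<le> Z t $ i"
  using assms unfolding solves_ORP_def by blast+

lemma solves_ORP_start:
  assumes "solves_ORP r \<xi> Z R"
  shows "R 0 = 0"
  using increase_set_zero[OF solves_ORP_increase[OF assms]] by (simp add: vec_eq_iff)

text \<open>Drift and reflection vectors have coordinate sum zero, so mass is conserved, and
  nonnegativity then bounds each coordinate by 1. It stands outside the locale so as to cover a
  single site as well.\<close>

lemma solves_ORP_unit_simplex:
  assumes orp: "solves_ORP r (\<lambda>t. u + t *\<^sub>R drift r) Z R"
    and "u \<in> unit_simplex" "0 \<le> t"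
  shows "Z t \<in> unit_simplex"
proof -
  have "(\<Sum>k\<in>UNIV. drift r $ k) = 0"
    unfolding drift_def by (simp add: sum_subtractf) (subst sum.swap, simp)
  moreover have "(\<Sum>k\<in>UNIV. (\<Sum>i\<in>UNIV. R t $ i *\<^sub>R reflection r i) $ k) = 0"
  proof -
    have "(\<Sum>k\<in>UNIV. reflection r i $ k) = 0" for i
      unfolding reflection_def sum_component
      by (subst sum.swap) (simp add: axis_def sum_subtractf flip: sum_distrib_left)
    then have "(\<Sum>i\<in>UNIV. R t $ i * (\<Sum>k\<in>UNIV. reflection r i $ k)) = 0"
      by simp
    then show ?thesis
      unfolding sum_component sum_distrib_left by (subst sum.swap) simp
  qed
  moreover have "Z t = u + t *\<^sub>R drift r + (\<Sum>i\<in>UNIV. R t $ i *\<^sub>R reflection r i)"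
    and nonneg: "\<And>k. 0 \<le> Z t $ k"
    by (fact solves_ORP_eq[OF orp \<open>0 \<le> t\<close>] solves_ORP_nonneg[OF orp \<open>0 \<le> t\<close>])+
  ultimately have sum1: "(\<Sum>k\<in>UNIV. Z t $ k) = 1"
    using \<open>u \<in> unit_simplex\<close>
    by (simp add: unit_simplex_def sum.distrib del: sum_component flip: sum_distrib_left)
  moreover have "Z t $ k \<le> 1" for k
    unfolding sum1[symmetric] by (rule member_le_sum) (use nonneg in auto)
  ultimately show ?thesis
    using nonneg by (simp add: unit_simplex_def)
qed

context irreducible_walk
begin

lemma reflection_component: "reflection r i $ k = of_bool (i = k) - p i k"
proof -
  have "reflection r i $ k = (\<Sum>j\<in>UNIV. p i j * of_bool (i = k)) - (\<Sum>j\<in>UNIV. p i j * of_bool (j = k))"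
    by (simp add: reflection_def axis_def of_bool_def right_diff_distrib sum_subtractf eq_commute[of k])
  also have "(\<Sum>j\<in>UNIV. p i j * of_bool (i = k)) = of_bool (i = k)"
    by (simp add: sum_jump_prob flip: sum_distrib_right)
  also have "(\<Sum>j\<in>UNIV. p i j * of_bool (j = k)) = p i k"
    by (simp add: of_bool_def if_distrib[where f = "(*) _"] cong: if_cong)
  finally show ?thesis .
qed

lemma solves_ORP_component:
  assumes "solves_ORP r (\<lambda>t. u + t *\<^sub>R drift r) Z R" "0 \<le> t"
  shows "Z t $ k = u $ k + t * drift r $ k + R t $ k - (\<Sum>i\<in>UNIV. R t $ i * p i k)"
proof -
  have "Z t = u + t *\<^sub>R drift r + (\<Sum>i\<in>UNIV. R t $ i *\<^sub>R reflection r i)"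
    by (fact solves_ORP_eq[OF assms])
  then have "Z t $ k = u $ k + t * drift r $ k + (\<Sum>i\<in>UNIV. R t $ i * (of_bool (i = k) - p i k))"
    by (simp add: reflection_component)
  also have "(\<Sum>i\<in>UNIV. R t $ i * (of_bool (i = k) - p i k)) =
      (\<Sum>i\<in>UNIV. if i = k then R t $ i else 0) - (\<Sum>i\<in>UNIV. R t $ i * p i k)"
    by (simp add: right_diff_distrib sum_subtractf of_bool_def if_distrib[where f = "(*) _"] cong: if_cong)
  finally show ?thesis
    by simp
qed

text \<open>Off \<open>A\<close>, \<open>(I - P) G\<close> is the identity, so pushing there
  contributes just \<open>R t $ j\<close>; on \<open>A\<close>, \<open>G\<close> vanishes and only
  \<open>- P G\<close> is left. The start \<open>u\<close> lives on \<open>A\<close>, where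
  \<open>G\<close> vanishes, and contributes nothing.\<close>

lemma solves_ORP_green:
  assumes orp: "solves_ORP r (\<lambda>t. u + t *\<^sub>R drift r) Z R"
    and "A \<noteq> {}" "j \<notin> A" "u \<in> simplex_face A" "0 \<le> t"
  shows "(\<Sum>k\<in>UNIV. Z t $ k * green A k j) =
    t * (\<Sum>k\<in>UNIV. drift r $ k * green A k j) + R t $ j
      - (\<Sum>i\<in>A. R t $ i * (\<Sum>k\<in>UNIV. p i k * green A k j))"
proof -
  have killed: "(\<Sum>k\<in>UNIV. u $ k * green A k j) = 0"
  proof (rule sum.neutral, rule ballI)
    show "u $ k * green A k j = 0" for k
      using \<open>u \<in> simplex_face A\<close> \<open>j \<notin> A\<close> by (cases "k \<in> A") (auto simp: simplex_face_iff green_killed)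
  qed
  have step: "R t $ i * green A i j - R t $ i * (\<Sum>k\<in>UNIV. p i k * green A k j) =
      (if i = j then R t $ j else 0) -
      (if i \<in> A then R t $ i * (\<Sum>k\<in>UNIV. p i k * green A k j) else 0)" for i
    using \<open>j \<notin> A\<close> green_first_step[OF \<open>A \<noteq> {}\<close> \<open>j \<notin> A\<close>, of i]
    by (cases "i \<in> A") (auto simp: green_killed algebra_simps)
  have "(\<Sum>k\<in>UNIV. Z t $ k * green A k j) =
      (\<Sum>k\<in>UNIV. u $ k * green A k j) + t * (\<Sum>k\<in>UNIV. drift r $ k * green A k j)
      + (\<Sum>k\<in>UNIV. R t $ k * green A k j) - (\<Sum>k\<in>UNIV. (\<Sum>i\<in>UNIV. R t $ i * p i k) * green A k j)"
    by (simp add: solves_ORP_component[OF orp \<open>0 \<le> t\<close>] sum.distrib sum_subtractf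
        sum_distrib_left algebra_simps)
  also have "(\<Sum>k\<in>UNIV. (\<Sum>i\<in>UNIV. R t $ i * p i k) * green A k j) =
      (\<Sum>i\<in>UNIV. R t $ i * (\<Sum>k\<in>UNIV. p i k * green A k j))"
    unfolding sum_distrib_left sum_distrib_right by (subst sum.swap) (simp add: mult.assoc)
  finally have "(\<Sum>k\<in>UNIV. Z t $ k * green A k j) =
      t * (\<Sum>k\<in>UNIV. drift r $ k * green A k j)
      + (\<Sum>i\<in>UNIV. R t $ i * green A i j - R t $ i * (\<Sum>k\<in>UNIV. p i k * green A k j))"
    by (simp add: killed sum_subtractf)
  then show ?thesis
    by (simp add: step sum_subtractf flip: sum.inter_restrict)
qed

section \<open>The two directions of the equivalence\<close>

lemma face_invariant_imp_absorbing:
  assumes orp: "solves_ORP r (\<lambda>t. u + t *\<^sub>R drift r) Z R"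
    and "A \<noteq> {}" and u: "u \<in> simplex_face A" "\<And>i. i \<in> A \<Longrightarrow> 0 < u $ i"
    and face: "\<And>t. 0 \<le> t \<Longrightarrow> Z t \<in> simplex_face A"
  shows "absorbing r A"
  unfolding absorbing_iff_green[OF \<open>A \<noteq> {}\<close>]
proof
  fix j assume "j \<in> -A"
  then have "j \<notin> A"
    by simp
  have "Z 0 $ k = u $ k" for k
    by (simp add: solves_ORP_component[OF orp] solves_ORP_start[OF orp])
  then have pos0: "0 < Z 0 $ i" if "i \<in> A" for i
    using u(2) that by simp
  have lim: "(Z \<longlongrightarrow> Z 0) (at_right 0)"
    using solves_ORP_cadlag[OF orp] by (simp add: cadlag_def)
  \<comment> \<open>Right-continuity at 0 keeps the finitely many coordinates in \<open>A\<close>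
    positive for a short time.\<close>
  have "\<forall>\<^sub>F t in at_right 0. \<forall>i\<in>A. 0 < Z t $ i"
    using order_tendstoD(1)[OF tendsto_vec_nth[OF lim] pos0]
    by (intro eventually_ball_finite) auto
  then obtain b where "0 < b" and b: "\<And>t i. 0 < t \<Longrightarrow> t < b \<Longrightarrow> i \<in> A \<Longrightarrow> 0 < Z t $ i"
    unfolding eventually_at_right_field by auto
  define t where "t = b / 2"
  have t: "0 < t" "t < b"
    using \<open>0 < b\<close> by (auto simp: t_def)
  \<comment> \<open>Pushing at \<open>i\<close> requires a zero of coordinate \<open>i\<close>, and
    there is none on \<open>(0, t]\<close>.\<close>
  have "R t $ i = R 0 $ i" if "i \<in> A" for i
  proof (rule increase_set_flat[OF solves_ORP_mono[OF orp] _
        solves_ORP_increase[OF orp]])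
    show "x \<notin> {s. Z s $ i = 0}" if "0 < x" "x \<le> t" for x
      using b[of x i] that t \<open>i \<in> A\<close> by simp
  qed (use t in simp_all)
  then have "(\<Sum>i\<in>A. R t $ i * (\<Sum>k\<in>UNIV. p i k * green A k j)) = 0"
    by (simp add: solves_ORP_start[OF orp])
  moreover have "(\<Sum>k\<in>UNIV. Z t $ k * green A k j) = 0"
  proof (rule sum.neutral, rule ballI)
    show "Z t $ k * green A k j = 0" for k
      using face[of t] t \<open>j \<notin> A\<close> by (cases "k \<in> A") (auto simp: simplex_face_iff green_killed)
  qed
  ultimately have "t * (\<Sum>k\<in>UNIV. drift r $ k * green A k j) = - (R t $ j)"
    using solves_ORP_green[OF orp \<open>A \<noteq> {}\<close> \<open>j \<notin> A\<close> u(1), of t] t by simp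
  also have "\<dots> \<le> 0"
    using mono_onD[OF solves_ORP_mono[OF orp], of 0 t j] t
    by (simp add: solves_ORP_start[OF orp])
  finally show "(\<Sum>k\<in>UNIV. drift r $ k * green A k j) \<le> 0"
    using t by (simp add: mult_le_0_iff)
qed

text \<open>\<open>D k\<close> is the excess of the pushing \<open>R $ k\<close> over what would keep the path on the face.
  Where \<open>Z $ k\<close> vanishes, \<open>D k\<close> equals \<open>\<Sum>j. D j * p j k\<close>, so the running suprema \<open>M\<close> of \<open>D\<close>
  satisfy \<open>M \<le> M P\<close> off \<open>A\<close>, which forces \<open>M = 0\<close> since the walk is transient off \<open>A\<close>.\<close>

lemma absorbing_imp_face_invariant:
  assumes orp: "solves_ORP r (\<lambda>t. u + t *\<^sub>R drift r) Z R"
    and "A \<noteq> {}" "u \<in> simplex_face A" "absorbing r A" "0 \<le> T"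
  shows "Z T \<in> simplex_face A"
proof -
  define D where "D j t = (\<Sum>k\<in>UNIV. Z t $ k * green A k j)" for j t
  define \<psi> where "\<psi> j t = (\<Sum>i\<in>A. R t $ i * (\<Sum>k\<in>UNIV. p i k * green A k j))
    - t * (\<Sum>k\<in>UNIV. drift r $ k * green A k j)" for j t
  define M where "M j = (SUP t\<in>{0..T}. D j t)" for j
  have D_eq: "D j t = R t $ j - \<psi> j t" if "j \<notin> A" "0 \<le> t" for j t
    using solves_ORP_green[OF orp \<open>A \<noteq> {}\<close> \<open>j \<notin> A\<close> \<open>u \<in> simplex_face A\<close> \<open>0 \<le> t\<close>]
    by (simp add: D_def \<psi>_def)
  have mono_R: "mono_on {0..} (\<lambda>t. R t $ i)" for i
    by (rule solves_ORP_mono[OF orp])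
  have Z_nonneg: "0 \<le> Z t $ k" if "0 \<le> t" for t k
    using orp that by (rule solves_ORP_nonneg)
  \<comment> \<open>Absorption enters here, making the drift term nondecreasing; the other terms are
    coordinates of \<open>R\<close> with nonnegative weights.\<close>
  have mono_\<psi>: "mono_on {0..} (\<psi> j)" if "j \<notin> A" for j
  proof (rule mono_onI)
    fix s t :: real assume "s \<in> {0..}" "t \<in> {0..}" "s \<le> t"
    have "t * (\<Sum>k\<in>UNIV. drift r $ k * green A k j) \<le> s * (\<Sum>k\<in>UNIV. drift r $ k * green A k j)"
      using \<open>absorbing r A\<close> \<open>j \<notin> A\<close> \<open>s \<le> t\<close>
      by (intro mult_right_mono_neg) (auto simp: absorbing_iff_green[OF \<open>A \<noteq> {}\<close>])
    moreover have "(\<Sum>i\<in>A. R s $ i * (\<Sum>k\<in>UNIV. p i k * green A k j)) \<le>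
        (\<Sum>i\<in>A. R t $ i * (\<Sum>k\<in>UNIV. p i k * green A k j))"
      using \<open>s \<in> {0..}\<close> \<open>t \<in> {0..}\<close> \<open>s \<le> t\<close> \<open>A \<noteq> {}\<close> \<open>j \<notin> A\<close>
      by (intro sum_mono mult_right_mono mono_onD[OF mono_R] sum_nonneg mult_nonneg_nonneg
          jump_prob_nonneg green_nonneg)
    ultimately show "\<psi> j s \<le> \<psi> j t"
      by (simp add: \<psi>_def)
  qed
  have \<psi>_0: "\<psi> j 0 = 0" for j
    by (simp add: \<psi>_def solves_ORP_start[OF orp])
  \<comment> \<open>\<open>\<psi> j\<close> starts at 0 and is nondecreasing, so \<open>D j\<close>
    never exceeds \<open>R T $ j\<close> and the suprema \<open>M\<close> are finite.\<close>
  have bdd: "bdd_above (D j ` {0..T})" if "j \<notin> A" for j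
  proof (rule bdd_aboveI2)
    fix t assume "t \<in> {0..T}"
    then have "R t $ j \<le> R T $ j" "\<psi> j 0 \<le> \<psi> j t"
      by (intro mono_onD[OF mono_R] mono_onD[OF mono_\<psi>[OF that]]; simp)+
    then show "D j t \<le> R T $ j"
      using \<open>t \<in> {0..T}\<close> that by (simp add: D_eq \<psi>_0)
  qed
  have D_le_M: "D j t \<le> M j" if "j \<notin> A" "0 \<le> t" "t \<le> T" for j t
    unfolding M_def using that by (intro cSUP_upper bdd) auto
  have D_0: "D j 0 = 0" if "j \<notin> A" for j
    using that by (simp add: D_eq \<psi>_0 solves_ORP_start[OF orp])
  have M_nonneg: "0 \<le> M j" if "j \<notin> A" for j
    using D_le_M[of j 0] D_0[of j] that \<open>0 \<le> T\<close> by simp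
  \<comment> \<open>The last-step identity \<open>G = I + G P\<close>, paired with
    \<open>Z t\<close>.\<close>
  have Z_eq: "D i t = Z t $ i + (\<Sum>j\<in>-A. D j t * p j i)" if "i \<notin> A" for i t
  proof -
    have "D i t = (\<Sum>k\<in>UNIV. Z t $ k * of_bool (k = i)) +
        (\<Sum>k\<in>UNIV. \<Sum>j\<in>-A. Z t $ k * green A k j * p j i)"
      unfolding D_def
      by (subst green_last_step[OF \<open>A \<noteq> {}\<close> that])
         (simp add: distrib_left sum.distrib sum_distrib_left mult.assoc)
    also have "(\<Sum>k\<in>UNIV. Z t $ k * of_bool (k = i)) = Z t $ i"
      by (simp add: of_bool_def if_distrib[where f = "(*) _"] cong: if_cong)
    also have "(\<Sum>k\<in>UNIV. \<Sum>j\<in>-A. Z t $ k * green A k j * p j i) = (\<Sum>j\<in>-A. D j t * p j i)"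
      unfolding D_def by (subst sum.swap) (simp add: sum_distrib_right)
    finally show ?thesis .
  qed
  have M_le: "M i \<le> (\<Sum>j\<in>-A. M j * p j i)" if "i \<notin> A" for i
    unfolding M_def[of i]
  proof (rule cSUP_least)
    fix t assume "t \<in> {0..T}"
    \<comment> \<open>The bound is checked only at zeros of \<open>Z $ i\<close>, where
      \<open>Z_eq\<close> expresses \<open>D i\<close> through the \<open>D j\<close>. Since
      \<open>R $ i\<close> increases only there and \<open>\<psi> i\<close> is nondecreasing, the
      barrier lemma extends it to every \<open>t\<close>.\<close>
    have "R t $ i - \<psi> i t \<le> (\<Sum>j\<in>-A. M j * p j i)"
    proof (rule increase_set_barrier[OF mono_R _ solves_ORP_increase[OF orp] mono_\<psi>[OF that]])
      show "R 0 $ i - \<psi> i 0 \<le> (\<Sum>j\<in>-A. M j * p j i)"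
        using M_nonneg jump_prob_nonneg
        by (auto simp: \<psi>_0 solves_ORP_start[OF orp] intro!: sum_nonneg mult_nonneg_nonneg)
      fix s assume s: "0 \<le> s" "s \<le> t" "s \<in> {s. Z s $ i = 0}"
      have "R s $ i - \<psi> i s = (\<Sum>j\<in>-A. D j s * p j i)"
        using Z_eq[OF that, of s] s that by (simp add: D_eq)
      also have "\<dots> \<le> (\<Sum>j\<in>-A. M j * p j i)"
        using s \<open>t \<in> {0..T}\<close> by (intro sum_mono mult_right_mono D_le_M jump_prob_nonneg) auto
      finally show "R s $ i - \<psi> i s \<le> (\<Sum>j\<in>-A. M j * p j i)" .
    qed (use \<open>t \<in> {0..T}\<close> in simp_all)
    then show "D i t \<le> (\<Sum>j\<in>-A. M j * p j i)"
      using \<open>t \<in> {0..T}\<close> that by (simp add: D_eq)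
  qed (use \<open>0 \<le> T\<close> in simp)
  have "Z T $ m = 0" if "m \<notin> A" for m
  proof -
    \<comment> \<open>Column \<open>m\<close> of the Green function inverts \<open>I - P\<close> off
      \<open>A\<close>: \<open>M m\<close> becomes a sum of the nonpositive entries of
      \<open>M - M P\<close> with nonnegative Green weights.\<close>
    have "M m = (\<Sum>j\<in>-A. M j * (green A j m - (\<Sum>i\<in>UNIV. p j i * green A i m)))"
      using that \<open>A \<noteq> {}\<close>
      by (simp add: green_first_step of_bool_def if_distrib[where f = "(*) _"] cong: if_cong)
    also have "\<dots> = (\<Sum>j\<in>-A. M j * green A j m) - (\<Sum>j\<in>-A. \<Sum>i\<in>-A. M j * (p j i * green A i m))"
    proof -
      have "(\<Sum>i\<in>UNIV. p j i * green A i m) = (\<Sum>i\<in>-A. p j i * green A i m)" for j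
        using that by (intro sum.mono_neutral_right) (auto simp: green_killed)
      then show ?thesis
        by (simp add: right_diff_distrib sum_subtractf sum_distrib_left)
    qed
    also have "\<dots> = (\<Sum>i\<in>-A. (M i - (\<Sum>j\<in>-A. M j * p j i)) * green A i m)"
      by (subst sum.swap[of "\<lambda>j i. M j * (p j i * green A i m)"])
         (simp add: left_diff_distrib sum_subtractf sum_distrib_right mult.assoc)
    also have "\<dots> \<le> 0"
      using M_le that \<open>A \<noteq> {}\<close>
      by (intro sum_nonpos mult_nonpos_nonneg green_nonneg) auto
    finally have "D m T \<le> 0"
      using D_le_M[OF that \<open>0 \<le> T\<close>] by simp
    \<comment> \<open>The remaining terms of \<open>Z_eq\<close> are nonnegative.\<close>
    moreover have "Z T $ m \<le> D m T"
    proof -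
      have "0 \<le> D j T" if "j \<notin> A" for j
        unfolding D_def using Z_nonneg[OF \<open>0 \<le> T\<close>] that \<open>A \<noteq> {}\<close>
        by (intro sum_nonneg mult_nonneg_nonneg green_nonneg) auto
      then have "0 \<le> (\<Sum>j\<in>-A. D j T * p j m)"
        by (intro sum_nonneg mult_nonneg_nonneg jump_prob_nonneg) auto
      then show ?thesis
        by (simp add: Z_eq[OF that])
    qed
    ultimately show ?thesis
      using Z_nonneg[OF \<open>0 \<le> T\<close>, of m] by simp
  qed
  moreover have "Z T \<in> unit_simplex"
    using solves_ORP_unit_simplex[OF orp _ \<open>0 \<le> T\<close>] \<open>u \<in> simplex_face A\<close>
    by (simp add: simplex_face_iff)
  ultimately show ?thesis
    by (simp add: simplex_face_iff)
qed

end

section \<open>Assembly of the equivalence\<close>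

lemma uniform_in_simplex_face:
  fixes A :: "'v::finite set"
  assumes "A \<noteq> {}"
  shows "(\<chi> i. of_bool (i \<in> A) / card A) \<in> simplex_face A"
proof -
  have "(\<Sum>i\<in>UNIV. of_bool (i \<in> A) / real (card A)) = (\<Sum>i\<in>A. 1 / real (card A))"
    by (intro sum.mono_neutral_cong_right) auto
  moreover have "1 \<le> card A"
    using assms by (simp add: Suc_le_eq card_gt_0_iff)
  ultimately show ?thesis
    using assms by (simp add: simplex_face_iff unit_simplex_def)
qed

theorem lemma3p14:
  fixes r :: "'v::finite \<Rightarrow> 'v \<Rightarrow> real"
    and \<zeta> :: "real ^ 'v \<Rightarrow> real \<Rightarrow> real ^ 'v"
    and A :: "'v set"
  assumes "irreducible_rates r"
    and "\<And>i. r i i = 0"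
    and "\<And>u. u \<in> unit_simplex \<Longrightarrow> \<exists>\<rho>. solves_ORP r (\<lambda>t. u + t *\<^sub>R drift r) (\<zeta> u) \<rho>"
    and "A \<noteq> {}"
  shows "absorbing r A \<longleftrightarrow>
           (\<forall>u\<in>simplex_face A. \<forall>t\<ge>0. \<zeta> u t \<in> simplex_face A)"
proof (cases "A = UNIV")
  \<comment> \<open>Both sides hold: absorption by definition, invariance because the face is the
    whole simplex. A single site, with zero exit rate, belongs here.\<close>
  case True
  moreover have "\<zeta> u t \<in> unit_simplex" if "u \<in> unit_simplex" "0 \<le> t" for u t
    using assms(3) solves_ORP_unit_simplex that by blast
  ultimately show ?thesis
    by (simp add: absorbing_def simplex_face_iff)
next
  case False
  have "0 < out_rate r i" for i
  proof -
    \<comment> \<open>\<open>A\<close> and its complement are both nonempty, so every site differs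
      from some other one.\<close>
    obtain a b where "a \<in> A" "b \<notin> A"
      using \<open>A \<noteq> {}\<close> \<open>A \<noteq> UNIV\<close> by blast
    then have "i \<noteq> a \<or> i \<noteq> b"
      by blast
    then show ?thesis
      using out_rate_pos[OF assms(1)] by blast
  qed
  then interpret irreducible_walk r
    using assms(1) by unfold_locales
  have simplex: "u \<in> unit_simplex" if "u \<in> simplex_face A" for u
    using that by (simp add: simplex_face_iff)
  show ?thesis
  proof (intro iffI ballI allI impI)
    fix u t assume "absorbing r A" and u: "u \<in> simplex_face A" and t: "0 \<le> (t::real)"
    obtain R where "solves_ORP r (\<lambda>t. u + t *\<^sub>R drift r) (\<zeta> u) R"
      using assms(3) simplex u by blast
    then show "\<zeta> u t \<in> simplex_face A"
      using \<open>A \<noteq> {}\<close> u \<open>absorbing r A\<close> t by (rule absorbing_imp_face_invariant)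
  next
    assume face: "\<forall>u\<in>simplex_face A. \<forall>t\<ge>0. \<zeta> u t \<in> simplex_face A"
    \<comment> \<open>The barycentre of the face has all coordinates in \<open>A\<close> strictly
      positive, as this direction requires of the start.\<close>
    define u :: "real ^ 'v" where "u = (\<chi> i. of_bool (i \<in> A) / card A)"
    have u: "u \<in> simplex_face A"
      unfolding u_def using \<open>A \<noteq> {}\<close> by (rule uniform_in_simplex_face)
    then obtain R where "solves_ORP r (\<lambda>t. u + t *\<^sub>R drift r) (\<zeta> u) R"
      using assms(3) simplex by blast
    then show "absorbing r A"
      using \<open>A \<noteq> {}\<close> u
    proof (rule face_invariant_imp_absorbing)
      show "0 < u $ i" if "i \<in> A" for i
        using that by (auto simp: u_def card_gt_0_iff)
      show "\<zeta> u t \<in> simplex_face A" if "0 \<le> t" for t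
        using face u that by blast
    qed
  qed
qed

end
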